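(* Let $\mathcal{L}$ be a non-empty set of $k$-spaces in $\mathrm{PG}(n,q)$, with $n\geq 2k+2$. Let $2k+1\leq t\leq n-1$ and suppose that $\mathcal{L}$ restricted to every $t$-dimensional subspace $\pi_i$ defines a Cameron-Liebler $k$-set of parameter $x_{\pi_i}$. Then the following properties are equivalent. \begin{enumerate} \item The set $\mathcal{L}$ is a Cameron-Liebler $k$-set of parameter $C$ in $\mathrm{PG}(n,q)$. \item For every $k$-space $K$, the number $C:=\chi_\mathcal{L}(K)+\frac{\left(\sum_{K \in \pi_i}x_{\pi_i}- \begin{bmatrix} n-k \\ t-k\end{bmatrix}_q\chi_\mathcal{L}(K) \right)} {\begin{bmatrix} n-k-1 \\ t-k-1\end{bmatrix}_q }$ is a constant independent from $K$. \end{enumerate} The sum of the parameters $x_{\pi_i}$ runs over all $t$-spaces through $K$.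
   Context: A Cameron-Liebler $k$-set in a projective space $\mathrm{PG}(m,q)$ is a set of $k$-spaces whose characteristic vector lies in the row space of the point-($k$-space) incidence matrix of that space; it has parameter $x$ if its size is $x\begin{bmatrix} m \\ k\end{bmatrix}_q$, where $\begin{bmatrix} b \\ a\end{bmatrix}_q=\frac{(q^b-1)\cdots(q^{b-a+1}-1)}{(q^a-1)\cdots(q-1)}$. $\chi_\mathcal{L}(K)$ is $1$ if $K\in\mathcal{L}$ and $0$ otherwise. *)

theory Defs
  imports "HOL-Analysis.Analysis"
begin

text \<open>
  \<open>PG(n,q)\<close> is modelled by the vector space \<^typ>\<open>'a ^ 'n\<close> over a finite field \<^typ>\<open>'a\<close> with
  \<open>CARD('a) = q\<close> and \<open>CARD('n) = n + 1\<close>.  Dimensions are projective, so a \<open>k\<close>-space is a linear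
  subspace of vector space dimension \<open>k + 1\<close>.  A subspace \<open>P\<close> of projective dimension \<open>m\<close> is
  itself a \<open>PG(m,q)\<close>; the notions below are relative to such a \<open>P\<close>, the whole geometry
  being \<open>P = UNIV\<close>.
\<close>

definition pg_spaces :: "nat \<Rightarrow> ('a::field ^ 'n) set \<Rightarrow> ('a ^ 'n) set set" where
  "pg_spaces k P = {S. vec.subspace S \<and> vec.dim S = k + 1 \<and> S \<subseteq> P}"

definition gauss_binomial :: "nat \<Rightarrow> nat \<Rightarrow> nat \<Rightarrow> real" where
  "gauss_binomial q b a =
     (\<Prod>i<a. real q ^ (b - i) - 1) / (\<Prod>i<a. real q ^ (a - i) - 1)"

text \<open>
  Rows and columns are indexed by all sets of vectors, so that the index type is
  independent of \<open>P\<close> and \<open>k\<close>; the rows not belonging to points of \<open>P\<close> and the columns not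
  belonging to \<open>k\<close>-spaces of \<open>P\<close> are zero.
\<close>

definition incidence_matrix ::
  "nat \<Rightarrow> ('a::{field,finite} ^ 'n) set \<Rightarrow> real ^ ('a ^ 'n) set ^ ('a ^ 'n) set" where
  "incidence_matrix k P =
     (\<chi> p K. if p \<in> pg_spaces 0 P \<and> K \<in> pg_spaces k P \<and> p \<subseteq> K then 1 else 0)"

definition char_vector ::
  "('a::{field,finite} ^ 'n) set set \<Rightarrow> real ^ ('a ^ 'n) set" where
  "char_vector L = (\<chi> K. indicator L K)"

definition cameron_liebler ::
  "nat \<Rightarrow> ('a::{field,finite} ^ 'n) set \<Rightarrow> ('a ^ 'n) set set \<Rightarrow> bool" where
  "cameron_liebler k P L \<longleftrightarrow>
     L \<subseteq> pg_spaces k P \<and> char_vector L \<in> span (rows (incidence_matrix k P))"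

definition cameron_liebler_param ::
  "nat \<Rightarrow> ('a::{field,finite} ^ 'n) set \<Rightarrow> ('a ^ 'n) set set \<Rightarrow> real \<Rightarrow> bool" where
  "cameron_liebler_param k P L x \<longleftrightarrow>
     cameron_liebler k P L \<and>
     real (card L) = x * gauss_binomial (CARD('a)) (vec.dim P - 1) k"

end

(* The restriction of L to a t-space pi is K |-> sum of w_pi(p) over the points p of K.  The
   weights w_pi are unique on every subspace of dimension at least k + 1.  For t >= 2k + 1 any
   two t-spaces through a point p are linked by a chain of t-spaces in which consecutive
   members share a (k + 1)-space through p, so the local weights glue to a global weight w
   (for k = 0 a weight exists trivially).  Hence L is always a Cameron-Liebler set, its
   parameter is the sum of w over all points, and x_pi is the sum of w over the points of pi.
   Counting the t-spaces through K and a further point then shows that the number in the second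
   property is the total weight for every K. *)
theory Submission
  imports Defs
begin

section \<open>Gaussian binomial coefficients\<close>

lemma gauss_binomial_0 [simp]: "gauss_binomial q b 0 = 1"
  by (simp add: gauss_binomial_def)

text \<open>Peeling off the factor \<open>i = 0\<close> above and below leaves the products for the
  lowered pair. The counting induction runs along this recursion.\<close>

lemma gauss_binomial_Suc_Suc:
  "gauss_binomial q (Suc b) (Suc a) =
     (real q ^ Suc b - 1) / (real q ^ Suc a - 1) * gauss_binomial q b a"
  by (simp add: gauss_binomial_def prod.lessThan_Suc_shift del: prod.lessThan_Suc power_Suc)

lemma gauss_binomial_pos:
  assumes "q \<ge> 2" and "a \<le> b"
  shows "gauss_binomial q b a > 0"
  using assms(2)
proof (induction a arbitrary: b)
  case (Suc a)
  then obtain b' where b': "b = Suc b'" "a \<le> b'"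
    by (cases b) auto
  have "real q ^ Suc m > 1" for m
    using assms(1) by (intro one_less_power) auto
  with Suc.IH[OF b'(2)] show ?case
    by (simp add: b'(1) gauss_binomial_Suc_Suc del: power_Suc)
qed simp

text \<open>The ratio in the recursion exceeds 1 exactly because \<open>a < b\<close>. Strictness
  later makes the coefficient of a single point weight nonzero.\<close>

lemma gauss_binomial_less_Suc_Suc:
  assumes "q \<ge> 2" and "a < b"
  shows "gauss_binomial q b a < gauss_binomial q (Suc b) (Suc a)"
proof -
  have "real q ^ Suc a > 1" "real q ^ Suc a < real q ^ Suc b"
    using assms by (auto intro!: one_less_power power_strict_increasing simp del: power_Suc)
  then have "(real q ^ Suc b - 1) / (real q ^ Suc a - 1) > 1"
    by (simp del: power_Suc)
  from mult_strict_right_mono[OF this gauss_binomial_pos[OF assms(1), of a b]] assms(2)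
  show ?thesis
    by (simp add: gauss_binomial_Suc_Suc del: power_Suc)
qed

section \<open>Counting subspaces between two subspaces\<close>

lemma two_le_card_field: "2 \<le> CARD('a::{field,finite})"
proof -
  have "card {0, 1 :: 'a} \<le> CARD('a)"
    by (intro card_mono) auto
  then show ?thesis by simp
qed

text \<open>Adjoining an independent \<open>b\<close> makes (c, v) |-> c b + v a bijection from
  scalars times the old span onto the new one, so the size is multiplied by q.\<close>

lemma card_span_independent:
  fixes B :: "('a::{field,finite} ^ 'n) set"
  assumes "vec.independent B"
  shows "card (vec.span B) = CARD('a) ^ card B"
proof -
  have "finite B" by simp
  then show ?thesis using assms
  proof (induction B)
    case (insert b B)
    let ?f = "\<lambda>(c, v). c *s b + v"
    have b: "b \<notin> vec.span B" and B: "vec.independent B"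
      using insert.prems insert.hyps by (auto simp: vec.independent_insert)
    have "inj_on ?f (UNIV \<times> vec.span B)"
    proof (rule inj_onI, clarify)
      fix c d u v
      assume uv: "u \<in> vec.span B" "v \<in> vec.span B" and eq: "c *s b + u = d *s b + v"
      from eq have diff: "(c - d) *s b = v - u"
        by (simp add: vec.scale_left_diff_distrib algebra_simps)
      have "c = d"
      proof (rule ccontr)
        assume "c \<noteq> d"
        then have "b = inverse (c - d) *s ((c - d) *s b)"
          by (simp only: vec.scale_scale left_inverse right_minus_eq vec.scale_one not_False_eq_True)
        then have "b = inverse (c - d) *s (v - u)"
          by (simp only: diff)
        then show False
          using b uv by (metis vec.span_diff vec.span_scale)
      qed
      with eq show "c = d \<and> u = v" by simp
    qed
    moreover have "?f ` (UNIV \<times> vec.span B) = vec.span (insert b B)"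
    proof (intro set_eqI iffI)
      fix y assume "y \<in> vec.span (insert b B)"
      then obtain c where "y - c *s b \<in> vec.span B"
        by (auto simp: vec.span_breakdown_eq)
      then show "y \<in> ?f ` (UNIV \<times> vec.span B)"
        by (intro image_eqI[of _ _ "(c, y - c *s b)"]) auto
    next
      fix y assume "y \<in> ?f ` (UNIV \<times> vec.span B)"
      then obtain c v where "y = c *s b + v" "v \<in> vec.span B" by auto
      then show "y \<in> vec.span (insert b B)"
        unfolding vec.span_breakdown_eq by (intro exI[of _ c]) simp
    qed
    ultimately have "card (vec.span (insert b B)) = CARD('a) * card (vec.span B)"
      by (metis card_image card_cartesian_product)
    then show ?case
      using insert.IH[OF B] insert.hyps by simp
  qed simp
qed

lemma card_subspace:
  fixes S :: "('a::{field,finite} ^ 'n) set"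
  assumes "vec.subspace S"
  shows "card S = CARD('a) ^ vec.dim S"
  by (metis assms card_span_independent vec.basis_exists vec.span_subspace)

lemma dim_insert_subspace:
  fixes A :: "('a::field ^ 'n) set"
  assumes "vec.subspace A" and "v \<notin> A"
  shows "vec.dim (insert v A) = Suc (vec.dim A)"
  using assms by (metis Suc_eq_plus1 vec.dim_insert vec.span_eq_iff)

text \<open>Here \<open>m\<close> is a vector space dimension, one more than the projective one. The
  members correspond to subspaces of the quotient P/A, and an arbitrary lower bound \<open>A\<close>
  lets the counting be done without forming quotients.\<close>

definition subspaces_between ::
  "('a::field ^ 'n) set \<Rightarrow> ('a ^ 'n) set \<Rightarrow> nat \<Rightarrow> ('a ^ 'n) set set" where
  "subspaces_between A P m = {B. vec.subspace B \<and> vec.dim B = m \<and> A \<subseteq> B \<and> B \<subseteq> P}"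

text \<open>Passing through a further vector only enlarges the lower bound, so the induction stays
  within the same family.\<close>

lemma subspaces_between_insert:
  assumes "vec.subspace A"
  shows "{B \<in> subspaces_between A P m. v \<in> B} = subspaces_between (vec.span (insert v A)) P m"
proof -
  have "vec.span (insert v A) \<subseteq> B \<longleftrightarrow> v \<in> B \<and> A \<subseteq> B" if "vec.subspace B" for B
    using that vec.span_minimal[of "insert v A" B] vec.span_superset[of "insert v A"] by blast
  then show ?thesis
    by (auto simp: subspaces_between_def)
qed

text \<open>Double count the pairs (v, B) with v in B but not in A. For fixed v the induction
  hypothesis applies with lower bound A + <v>; for fixed B the number of v is a difference of two
  powers of q.\<close>

lemma card_subspaces_between:
  fixes A P :: "('a::{field,finite} ^ 'n) set"
  assumes "vec.subspace A" and "vec.subspace P" and "A \<subseteq> P"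
    and "vec.dim P = vec.dim A + b" and "j \<le> b"
  shows "real (card (subspaces_between A P (vec.dim A + j))) = gauss_binomial (CARD('a)) b j"
  using assms
proof (induction j arbitrary: A b)
  case 0
  have "subspaces_between A P (vec.dim A) = {A}"
  proof (intro set_eqI iffI)
    fix B assume "B \<in> subspaces_between A P (vec.dim A)"
    then show "B \<in> {A}"
      using 0 vec.subspace_dim_equal[of A B] by (simp add: subspaces_between_def)
  qed (use 0 in \<open>simp add: subspaces_between_def\<close>)
  then show ?case by simp
next
  case (Suc j)
  let ?q = "real (CARD('a))"
  obtain b' where b': "b = Suc b'" "j \<le> b'"
    using Suc.prems(5) by (cases b) auto
  define a where "a = vec.dim A"
  define X where "X = subspaces_between A P (a + Suc j)"
  have diff: "real (card (B - A)) = ?q ^ vec.dim B - ?q ^ a"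
    if "vec.subspace B" "A \<subseteq> B" for B
  proof -
    have "card A \<le> card B"
      using that by (intro card_mono) auto
    moreover have "card (B - A) = card B - card A"
      using that by (intro card_Diff_subset) auto
    ultimately show ?thesis
      using that Suc.prems(1) by (simp add: of_nat_diff card_subspace a_def)
  qed
  have through: "real (card {B \<in> X. v \<in> B}) = gauss_binomial (CARD('a)) b' j"
    if "v \<in> P - A" for v
  proof -
    let ?A = "vec.span (insert v A)"
    have "vec.dim ?A = Suc a"
      using that Suc.prems(1) by (simp add: dim_insert_subspace a_def)
    moreover have "?A \<subseteq> P"
      using that Suc.prems(2,3) by (intro vec.span_minimal) auto
    ultimately show ?thesis
      using Suc.IH[of ?A b'] Suc.prems b'
      by (simp add: X_def subspaces_between_insert a_def)
  qed
  have "(?q ^ (a + Suc b') - ?q ^ a) * gauss_binomial (CARD('a)) b' j =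
      (\<Sum>v\<in>P - A. real (card {B \<in> X. v \<in> B}))"
    using through diff[of P] Suc.prems by (simp add: b' a_def)
  also have "\<dots> = (\<Sum>B\<in>X. real (card {v \<in> P - A. v \<in> B}))"
    using sum.swap_restrict[of "P - A" X "\<lambda>_ _. 1::real" "\<lambda>v B. v \<in> B"] by simp
  also have "\<dots> = (\<Sum>B\<in>X. ?q ^ (a + Suc j) - ?q ^ a)"
  proof (rule sum.cong)
    fix B assume B: "B \<in> X"
    then have "{v \<in> P - A. v \<in> B} = B - A"
      by (auto simp: X_def subspaces_between_def)
    then show "real (card {v \<in> P - A. v \<in> B}) = ?q ^ (a + Suc j) - ?q ^ a"
      using B diff[of B] by (simp add: X_def subspaces_between_def)
  qed simp
  \<comment> \<open>Both differences of powers share the factor q^a; cancelling it leaves the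
    recursion for Gaussian binomials.\<close>
  finally have "?q ^ a * ((?q ^ Suc b' - 1) * gauss_binomial (CARD('a)) b' j) =
      ?q ^ a * (real (card X) * (?q ^ Suc j - 1))"
    by (simp add: power_add algebra_simps)
  then have "(?q ^ Suc b' - 1) * gauss_binomial (CARD('a)) b' j = real (card X) * (?q ^ Suc j - 1)"
    by simp
  moreover have "?q ^ Suc j > 1"
    using two_le_card_field[where 'a='a] by (intro one_less_power) auto
  ultimately show ?case
    by (simp add: b' gauss_binomial_Suc_Suc X_def a_def field_simps del: power_Suc)
qed

text \<open>Existence is read off from the positivity of the count.\<close>

lemma subspaces_between_nonempty:
  fixes A P :: "('a::{field,finite} ^ 'n) set"
  assumes "vec.subspace A" and "vec.subspace P" and "A \<subseteq> P"
    and "vec.dim A \<le> m" and "m \<le> vec.dim P"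
  obtains B where "vec.subspace B" "vec.dim B = m" "A \<subseteq> B" "B \<subseteq> P"
proof -
  have "real (card (subspaces_between A P m)) =
      gauss_binomial (CARD('a)) (vec.dim P - vec.dim A) (m - vec.dim A)"
    using card_subspaces_between[of A P "vec.dim P - vec.dim A" "m - vec.dim A"] assms by simp
  also have "\<dots> > 0"
    using assms by (intro gauss_binomial_pos two_le_card_field) auto
  finally have "subspaces_between A P m \<noteq> {}"
    by auto
  then show thesis
    using that by (auto simp: subspaces_between_def)
qed

lemma dim_span_Un:
  fixes S T :: "('a::field ^ 'n) set"
  assumes "vec.subspace S" and "vec.subspace T"
  shows "vec.dim (vec.span (S \<union> T)) + vec.dim (S \<inter> T) = vec.dim S + vec.dim T"
proof -
  have "vec.span (S \<union> T) = {x + y |x y. x \<in> S \<and> y \<in> T}"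
    using assms by (auto simp: vec.span_Un vec.span_eq_iff[THEN iffD2])
  then show ?thesis
    using vec.dim_sums_Int[OF assms] by simp
qed

section \<open>Sums of point weights\<close>

lemma pg_spaces_eq_subspaces_between:
  "pg_spaces k P = subspaces_between {0} P (Suc k)"
  by (auto simp: pg_spaces_def subspaces_between_def dest: vec.subspace_0)

lemma points_within:
  "B \<subseteq> P \<Longrightarrow> {p \<in> pg_spaces 0 P. p \<subseteq> B} = pg_spaces 0 B"
  by (auto simp: pg_spaces_def)

lemma point_eq_span:
  assumes "p \<in> pg_spaces 0 P" and "v \<in> p" and "v \<noteq> 0"
  shows "p = vec.span {v}"
  using assms vec.subspace_dim_equal[of "vec.span {v}" p]
  by (auto simp: pg_spaces_def vec.span_minimal)

lemma points_of_point:
  assumes "p \<in> pg_spaces 0 P"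
  shows "pg_spaces 0 p = {p}"
  using assms vec.subspace_dim_equal by (fastforce simp: pg_spaces_def)

lemma points_of_zero [simp]: "pg_spaces 0 {0} = {}"
  by (auto simp: pg_spaces_def) (metis One_nat_def vec.dim_eq_0 zero_neq_one)

text \<open>After swapping the sums, each weight is multiplied by the number of B through its point.
  A point of A lies in every B; a point outside A enlarges the lower bound by one dimension, which
  lowers both indices. It is used with A zero, a point, and a k-space.\<close>

lemma sum_subspaces_between_sum_points:
  fixes A P :: "('a::{field,finite} ^ 'n) set" and w :: "('a ^ 'n) set \<Rightarrow> real"
  assumes A: "vec.subspace A" and P: "vec.subspace P" and AP: "A \<subseteq> P"
    and dimP: "vec.dim P = vec.dim A + Suc b" and "j \<le> b"
  shows "(\<Sum>B\<in>subspaces_between A P (vec.dim A + Suc j). \<Sum>p\<in>pg_spaces 0 B. w p) =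
    gauss_binomial (CARD('a)) (Suc b) (Suc j) * (\<Sum>p\<in>pg_spaces 0 A. w p)
    + gauss_binomial (CARD('a)) b j * ((\<Sum>p\<in>pg_spaces 0 P. w p) - (\<Sum>p\<in>pg_spaces 0 A. w p))"
proof -
  define X where "X = subspaces_between A P (vec.dim A + Suc j)"
  have inside: "real (card {B \<in> X. p \<subseteq> B}) = gauss_binomial (CARD('a)) (Suc b) (Suc j)"
    if "p \<in> pg_spaces 0 A" for p
  proof -
    have "{B \<in> X. p \<subseteq> B} = X"
      using that by (auto simp: X_def subspaces_between_def pg_spaces_def)
    then show ?thesis
      using card_subspaces_between[OF A P AP dimP, of "Suc j"] assms(5) by (simp add: X_def)
  qed
  have outside: "real (card {B \<in> X. p \<subseteq> B}) = gauss_binomial (CARD('a)) b j"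
    if p: "p \<in> pg_spaces 0 P - pg_spaces 0 A" for p
  proof -
    obtain v where v: "v \<in> p" "v \<notin> A"
      using p by (auto simp: pg_spaces_def)
    then have "v \<noteq> 0"
      using vec.subspace_0[OF A] by auto
    with p v have p_eq: "p = vec.span {v}"
      using point_eq_span by blast
    \<comment> \<open>A point is spanned by any nonzero vector of it, so containing \<open>p\<close>
      reduces to containing the chosen \<open>v\<close> outside \<open>A\<close>.\<close>
    have "p \<subseteq> B \<longleftrightarrow> v \<in> B" if "vec.subspace B" for B
      using that v(1) vec.span_minimal[of "{v}" B] by (auto simp: p_eq)
    then have "{B \<in> X. p \<subseteq> B} = {B \<in> X. v \<in> B}"
      by (auto simp: X_def subspaces_between_def)
    also have "\<dots> = subspaces_between (vec.span (insert v A)) P (vec.dim A + Suc j)"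
      using A by (simp add: X_def subspaces_between_insert)
    finally have eq: "{B \<in> X. p \<subseteq> B} = \<dots>" .
    have "vec.dim (vec.span (insert v A)) = Suc (vec.dim A)"
      using A v by (simp add: dim_insert_subspace)
    moreover have "vec.span (insert v A) \<subseteq> P"
      using v p AP P by (intro vec.span_minimal) (auto simp: pg_spaces_def)
    ultimately show ?thesis
      using card_subspaces_between[of "vec.span (insert v A)" P b j] P dimP assms(5)
      by (simp add: eq)
  qed
  have sub: "pg_spaces 0 A \<subseteq> pg_spaces 0 P"
    using AP by (auto simp: pg_spaces_def)
  have "(\<Sum>B\<in>X. \<Sum>p\<in>pg_spaces 0 B. w p) =
      (\<Sum>B\<in>X. \<Sum>p | p \<in> pg_spaces 0 P \<and> p \<subseteq> B. w p)"
    by (intro sum.cong) (auto simp: X_def subspaces_between_def points_within)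
  also have "\<dots> = (\<Sum>p\<in>pg_spaces 0 P. \<Sum>B | B \<in> X \<and> p \<subseteq> B. w p)"
    by (intro sum.swap_restrict) simp_all
  also have "\<dots> = (\<Sum>p\<in>pg_spaces 0 P. real (card {B \<in> X. p \<subseteq> B}) * w p)"
    by simp
  also have "\<dots> = (\<Sum>p\<in>pg_spaces 0 P - pg_spaces 0 A. real (card {B \<in> X. p \<subseteq> B}) * w p)
      + (\<Sum>p\<in>pg_spaces 0 A. real (card {B \<in> X. p \<subseteq> B}) * w p)"
    using sub by (intro sum.subset_diff) simp_all
  also have "\<dots> = gauss_binomial (CARD('a)) b j * (\<Sum>p\<in>pg_spaces 0 P - pg_spaces 0 A. w p)
      + gauss_binomial (CARD('a)) (Suc b) (Suc j) * (\<Sum>p\<in>pg_spaces 0 A. w p)"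
    by (simp add: inside outside sum_distrib_left)
  finally show ?thesis
    using sub by (simp add: X_def sum_diff)
qed

text \<open>The case A = {0}: it has no points, so only the total weight survives. Its coefficient
  is the binomial that normalises the parameter of a Cameron-Liebler set.\<close>

lemma sum_pg_spaces_sum_points:
  fixes P :: "('a::{field,finite} ^ 'n) set" and w :: "('a ^ 'n) set \<Rightarrow> real"
  assumes "vec.subspace P" and "k < vec.dim P"
  shows "(\<Sum>K\<in>pg_spaces k P. \<Sum>p\<in>pg_spaces 0 K. w p) =
    (\<Sum>p\<in>pg_spaces 0 P. w p) * gauss_binomial (CARD('a)) (vec.dim P - 1) k"
proof -
  obtain b where "vec.dim P = Suc b" "k \<le> b"
    using assms(2) by (cases "vec.dim P") auto
  moreover have "{0} \<subseteq> P"
    using assms(1) vec.subspace_0 by blast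
  ultimately show ?thesis
    using sum_subspaces_between_sum_points[of "{0}" P b k w] assms(1)
    by (simp add: pg_spaces_eq_subspaces_between[of k] vec.subspace_single_0 mult.commute)
qed

text \<open>Uniqueness of weights. Summing over all k-spaces shows that the total weight vanishes;
  summing over those through \<open>p\<close> then leaves \<open>w p\<close> times the number of
  k-spaces through one point minus the number through two, which is positive.\<close>

lemma point_weights_zero:
  fixes P :: "('a::{field,finite} ^ 'n) set" and w :: "('a ^ 'n) set \<Rightarrow> real"
  assumes P: "vec.subspace P" and dimP: "k + 2 \<le> vec.dim P" and "k \<ge> 1"
    and zero: "\<And>K. K \<in> pg_spaces k P \<Longrightarrow> (\<Sum>p\<in>pg_spaces 0 K. w p) = 0"
    and p: "p \<in> pg_spaces 0 P"
  shows "w p = 0"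
proof -
  let ?g = "gauss_binomial (CARD('a))"
  obtain j where j: "k = Suc j"
    using \<open>k \<ge> 1\<close> by (cases k) auto
  obtain b where b: "vec.dim P = Suc (Suc b)" "j < b"
    using dimP j by (metis Suc_le_D Suc_le_eq add_2_eq_Suc' Suc_le_mono)
  have "(\<Sum>p\<in>pg_spaces 0 P. w p) * ?g (Suc b) k = 0"
    using sum_pg_spaces_sum_points[OF P, of k w] zero b j by simp
  moreover have "?g (Suc b) k > 0"
    using b j by (intro gauss_binomial_pos two_le_card_field) auto
  ultimately have total: "(\<Sum>p\<in>pg_spaces 0 P. w p) = 0"
    by simp
  have p': "vec.subspace p" "p \<subseteq> P" "vec.dim p = 1"
    using p by (auto simp: pg_spaces_def)
  have "subspaces_between p P (Suc k) \<subseteq> pg_spaces k P"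
    by (auto simp: subspaces_between_def pg_spaces_def)
  then have "(\<Sum>B\<in>subspaces_between p P (Suc k). \<Sum>p\<in>pg_spaces 0 B. w p) = 0"
    using zero by (intro sum.neutral) blast
  then have "(?g (Suc b) (Suc j) - ?g b j) * w p = 0"
    using sum_subspaces_between_sum_points[OF p'(1) P p'(2), of b j w] b total
    by (auto simp: p' j points_of_point[OF p] algebra_simps)
  moreover have "?g b j < ?g (Suc b) (Suc j)"
    using b by (intro gauss_binomial_less_Suc_Suc two_le_card_field)
  ultimately show ?thesis
    by simp
qed

section \<open>Cameron-Liebler sets as sums of point weights\<close>

text \<open>Since \<open>rows M\<close> is a set, equal rows collapse in it. Indexing the
  coefficients by row positions instead yields a weight for each point.\<close>

lemma in_span_rows_iff:
  fixes M :: "real ^ 'c ^ 'r"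
  shows "v \<in> span (rows M) \<longleftrightarrow> (\<exists>w. v = (\<Sum>i\<in>UNIV. w i *\<^sub>R row i M))"
proof
  assume "v \<in> span (rows M)"
  then show "\<exists>w. v = (\<Sum>i\<in>UNIV. w i *\<^sub>R row i M)"
  proof (induction rule: span_induct_alt)
    case base
    show ?case by (intro exI[of _ "\<lambda>_. 0"]) simp
  next
    case (step c r y)
    then obtain w i where "y = (\<Sum>i\<in>UNIV. w i *\<^sub>R row i M)" "r = row i M"
      by (auto simp: rows_def)
    then have "c *\<^sub>R r + y = (\<Sum>l\<in>UNIV. (w l + (if l = i then c else 0)) *\<^sub>R row l M)"
      by (simp add: scaleR_add_left sum.distrib if_distrib[of "\<lambda>a. a *\<^sub>R _"] cong: if_cong)
    then show ?case
      by (intro exI[of _ "\<lambda>l. w l + (if l = i then c else 0)"])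
  qed
next
  assume "\<exists>w. v = (\<Sum>i\<in>UNIV. w i *\<^sub>R row i M)"
  then obtain w where "v = (\<Sum>i\<in>UNIV. w i *\<^sub>R row i M)" ..
  moreover have "row i M \<in> span (rows M)" for i
    by (rule span_base) (auto simp: rows_def)
  ultimately show "v \<in> span (rows M)"
    by (simp add: span_sum span_scale)
qed

lemma cameron_liebler_iff_point_weights:
  fixes P :: "('a::{field,finite} ^ 'n) set"
  assumes "L \<subseteq> pg_spaces k P"
  shows "cameron_liebler k P L \<longleftrightarrow>
    (\<exists>w :: ('a ^ 'n) set \<Rightarrow> real. \<forall>K\<in>pg_spaces k P. indicator L K = (\<Sum>p\<in>pg_spaces 0 K. w p))"
proof -
  have "char_vector L = (\<Sum>p\<in>UNIV. w p *\<^sub>R row p (incidence_matrix k P)) \<longleftrightarrow>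
      (\<forall>K\<in>pg_spaces k P. indicator L K = (\<Sum>p\<in>pg_spaces 0 K. w p))" for w :: "('a ^ 'n) set \<Rightarrow> real"
  proof -
    have "(\<Sum>p\<in>UNIV. w p *\<^sub>R row p (incidence_matrix k P)) $ K =
        (if K \<in> pg_spaces k P then \<Sum>p\<in>pg_spaces 0 K. w p else 0)" for K
    proof (cases "K \<in> pg_spaces k P")
      case True
      then have "K \<subseteq> P" by (simp add: pg_spaces_def)
      have "(\<Sum>p\<in>UNIV. w p *\<^sub>R row p (incidence_matrix k P)) $ K =
          (\<Sum>p\<in>UNIV. if p \<in> {p \<in> pg_spaces 0 P. p \<subseteq> K} then w p else 0)"
        using True by (auto simp: row_def incidence_matrix_def intro!: sum.cong)
      also have "\<dots> = (\<Sum>p\<in>pg_spaces 0 K. w p)"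
        unfolding points_within[OF \<open>K \<subseteq> P\<close>] by (simp flip: sum.inter_restrict)
      finally show ?thesis using True by simp
    next
      case False
      then show ?thesis
        by (simp add: row_def incidence_matrix_def)
    qed
    \<comment> \<open>At columns that are not k-spaces of \<open>P\<close> both vectors vanish, so
      equality need only be tested on k-spaces.\<close>
    moreover have "indicator L K = (0::real)" if "K \<notin> pg_spaces k P" for K
      using that assms by (auto simp: indicator_def)
    ultimately show ?thesis
      by (auto simp: vec_eq_iff char_vector_def)
  qed
  then show ?thesis
    using assms by (simp add: cameron_liebler_def in_span_rows_iff)
qed

lemma card_eq_sum_point_weights:
  fixes P :: "('a::{field,finite} ^ 'n) set"
  assumes "vec.subspace P" and "k < vec.dim P" and "L \<subseteq> pg_spaces k P"
    and "\<And>K. K \<in> pg_spaces k P \<Longrightarrow> indicator L K = (\<Sum>p\<in>pg_spaces 0 K. w p)"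
  shows "real (card L) = (\<Sum>p\<in>pg_spaces 0 P. w p) * gauss_binomial (CARD('a)) (vec.dim P - 1) k"
proof -
  have "real (card L) = (\<Sum>K\<in>pg_spaces k P. indicator L K)"
    using assms(3) by (simp add: indicator_def sum.If_cases Int_absorb1)
  also have "\<dots> = (\<Sum>K\<in>pg_spaces k P. \<Sum>p\<in>pg_spaces 0 K. w p)"
    using assms(4) by simp
  finally show ?thesis
    using sum_pg_spaces_sum_points[OF assms(1,2)] by simp
qed

text \<open>A weight already witnesses the span condition, and dividing the size by the positive
  binomial identifies the parameter as the total weight.\<close>

lemma cameron_liebler_param_iff:
  fixes P :: "('a::{field,finite} ^ 'n) set"
  assumes "vec.subspace P" and "k < vec.dim P" and "L \<subseteq> pg_spaces k P"
    and "\<And>K. K \<in> pg_spaces k P \<Longrightarrow> indicator L K = (\<Sum>p\<in>pg_spaces 0 K. w p)"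
  shows "cameron_liebler_param k P L x \<longleftrightarrow> x = (\<Sum>p\<in>pg_spaces 0 P. w p)"
proof -
  have "cameron_liebler k P L"
    using assms(4) cameron_liebler_iff_point_weights[OF assms(3)] by blast
  moreover have "gauss_binomial (CARD('a)) (vec.dim P - 1) k > 0"
    using assms(2) by (intro gauss_binomial_pos two_le_card_field) auto
  ultimately show ?thesis
    using card_eq_sum_point_weights[OF assms] by (auto simp: cameron_liebler_param_def)
qed

section \<open>Gluing local point weights\<close>

lemma global_point_weights:
  fixes L :: "('a::{field,finite} ^ 'n) set set"
  assumes "2 * k + 1 \<le> t" and "t < CARD('n)"
    and local: "\<And>\<pi>. \<pi> \<in> pg_spaces t UNIV \<Longrightarrow> cameron_liebler k \<pi> {K \<in> L. K \<subseteq> \<pi>}"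
  obtains w :: "('a ^ 'n) set \<Rightarrow> real"
  where "\<And>K. K \<in> pg_spaces k UNIV \<Longrightarrow> indicator L K = (\<Sum>p\<in>pg_spaces 0 K. w p)"
proof (cases "k = 0")
  case True
  \<comment> \<open>For k = 0 a k-space is its own only point, so the indicator itself is a
    weight.\<close>
  show thesis
    using True by (intro that[of "indicator L"]) (simp add: points_of_point)
next
  case False
  have dimU: "vec.dim (UNIV :: ('a ^ 'n) set) = CARD('n)"
    by (rule vec_dim_card)
  have "\<exists>w :: ('a ^ 'n) set \<Rightarrow> real. \<forall>K\<in>pg_spaces k \<pi>. indicator L K = (\<Sum>p\<in>pg_spaces 0 K. w p)"
    if \<pi>: "\<pi> \<in> pg_spaces t UNIV" for \<pi>
  proof -
    have sub: "{K \<in> L. K \<subseteq> \<pi>} \<subseteq> pg_spaces k \<pi>"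
      using local[OF \<pi>] by (simp add: cameron_liebler_def)
    have "indicator {K \<in> L. K \<subseteq> \<pi>} K = (indicator L K :: real)"
      if "K \<in> pg_spaces k \<pi>" for K
      using that by (auto simp: indicator_def pg_spaces_def)
    moreover obtain w :: "('a ^ 'n) set \<Rightarrow> real" where
      "\<forall>K\<in>pg_spaces k \<pi>. indicator {K \<in> L. K \<subseteq> \<pi>} K = (\<Sum>p\<in>pg_spaces 0 K. w p)"
      using local[OF \<pi>] cameron_liebler_iff_point_weights[OF sub] by blast
    ultimately show ?thesis
      by (intro exI[of _ w]) simp
  qed
  then obtain W :: "('a ^ 'n) set \<Rightarrow> ('a ^ 'n) set \<Rightarrow> real"
    where W: "\<And>\<pi> K. \<pi> \<in> pg_spaces t UNIV \<Longrightarrow> K \<in> pg_spaces k \<pi> \<Longrightarrow>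
      indicator L K = (\<Sum>p\<in>pg_spaces 0 K. W \<pi> p)"
    by metis
  \<comment> \<open>The difference of the two local weights sums to zero over every k-space of the
    common (k+1)-space \<open>S\<close>, so uniqueness inside \<open>S\<close> applies.\<close>
  have agree: "W \<pi> p = W \<rho> p"
    if "\<pi> \<in> pg_spaces t UNIV" "\<rho> \<in> pg_spaces t UNIV" "vec.subspace S" "vec.dim S = k + 2"
      "S \<subseteq> \<pi>" "S \<subseteq> \<rho>" "p \<in> pg_spaces 0 S" for \<pi> \<rho> S p
  proof -
    have "W \<pi> p - W \<rho> p = 0"
    proof (rule point_weights_zero[where w = "\<lambda>p. W \<pi> p - W \<rho> p"])
      fix K assume "K \<in> pg_spaces k S"
      then have "K \<in> pg_spaces k \<pi>" "K \<in> pg_spaces k \<rho>"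
        using that by (auto simp: pg_spaces_def)
      then show "(\<Sum>p\<in>pg_spaces 0 K. W \<pi> p - W \<rho> p) = 0"
        using W that by (simp add: sum_subtractf flip: W)
    qed (use that False in auto)
    then show ?thesis by simp
  qed
  \<comment> \<open>Sharing a line bounds the vector dimension of the span by 2(k + 2) - 2 = 2k + 2,
    which fits into t + 1. This is where t \<ge> 2k + 1 enters.\<close>
  have join: "\<exists>\<sigma>\<in>pg_spaces t UNIV. S \<subseteq> \<sigma> \<and> S' \<subseteq> \<sigma>"
    if "vec.subspace S" "vec.dim S = k + 2" "vec.subspace S'" "vec.dim S' = k + 2"
      "l \<subseteq> S" "l \<subseteq> S'" "vec.dim l = 2" for S S' l :: "('a ^ 'n) set"
  proof -
    have "vec.dim l \<le> vec.dim (S \<inter> S')"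
      using that by (intro vec.dim_subset) auto
    then have "vec.dim (vec.span (S \<union> S')) \<le> t + 1"
      using dim_span_Un[of S S'] that assms(1) by simp
    then obtain \<sigma> where "vec.subspace \<sigma>" "vec.dim \<sigma> = t + 1" "vec.span (S \<union> S') \<subseteq> \<sigma>"
      using subspaces_between_nonempty[of "vec.span (S \<union> S')" UNIV "t + 1"] assms(2) dimU by auto
    moreover have "S \<union> S' \<subseteq> vec.span (S \<union> S')"
      by (rule vec.span_superset)
    ultimately show ?thesis
      by (auto simp: pg_spaces_def)
  qed
  \<comment> \<open>Spaces \<open>S\<close> in \<pi> and \<open>S'\<close> in \<rho> may share only
    \<open>p\<close>, and then span too much for \<open>join\<close>. A third space \<open>T\<close>
    containing a line of each through \<open>p\<close> bridges them: the chain is \<pi>, S,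
    \<sigma>, T, \<tau>, S', \<rho>.\<close>
  have indep: "W \<pi> p = W \<rho> p"
    if \<pi>: "\<pi> \<in> pg_spaces t UNIV" and \<rho>: "\<rho> \<in> pg_spaces t UNIV"
      and p: "p \<in> pg_spaces 0 \<pi>" "p \<in> pg_spaces 0 \<rho>" for \<pi> \<rho> p
  proof -
    have p': "vec.subspace p" "vec.dim p = 1"
      using p by (auto simp: pg_spaces_def)
    have *: "\<exists>l S. vec.subspace l \<and> vec.dim l = 2 \<and> p \<subseteq> l \<and> l \<subseteq> S \<and>
        vec.subspace S \<and> vec.dim S = k + 2 \<and> S \<subseteq> \<sigma>"
      if \<sigma>: "\<sigma> \<in> pg_spaces t UNIV" "p \<in> pg_spaces 0 \<sigma>" for \<sigma>
    proof -
      have s: "vec.subspace \<sigma>" "vec.dim \<sigma> = t + 1" "p \<subseteq> \<sigma>"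
        using \<sigma> by (auto simp: pg_spaces_def)
      obtain l where l: "vec.subspace l" "vec.dim l = 2" "p \<subseteq> l" "l \<subseteq> \<sigma>"
        using subspaces_between_nonempty[of p \<sigma> 2] p' s assms(1) False by auto
      obtain S where "vec.subspace S" "vec.dim S = k + 2" "l \<subseteq> S" "S \<subseteq> \<sigma>"
        using subspaces_between_nonempty[of l \<sigma> "k + 2"] l s assms(1) False by auto
      with l show ?thesis by blast
    qed
    obtain l S where l: "vec.subspace l" "vec.dim l = 2" "p \<subseteq> l" "l \<subseteq> S"
      and S: "vec.subspace S" "vec.dim S = k + 2" "S \<subseteq> \<pi>"
      using *[OF \<pi> p(1)] by blast
    obtain l' S' where l': "vec.subspace l'" "vec.dim l' = 2" "p \<subseteq> l'" "l' \<subseteq> S'"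
      and S': "vec.subspace S'" "vec.dim S' = k + 2" "S' \<subseteq> \<rho>"
      using *[OF \<rho> p(2)] by blast
    have "vec.dim p \<le> vec.dim (l \<inter> l')"
      using l l' by (intro vec.dim_subset) auto
    \<comment> \<open>Two lines through \<open>p\<close> span vector dimension at most 3, which is
      at most k + 2 because k is positive here.\<close>
    then have dim3: "vec.dim (vec.span (l \<union> l')) \<le> k + 2"
      using dim_span_Un[of l l'] l l' p' False by simp
    have "vec.dim S \<le> CARD('n)"
      by (rule dim_subset_UNIV_cart_gen)
    then obtain T where T: "vec.subspace T" "vec.dim T = k + 2" "vec.span (l \<union> l') \<subseteq> T"
      using subspaces_between_nonempty[of "vec.span (l \<union> l')" UNIV "k + 2"] dim3 S dimU by auto
    then have lT: "l \<subseteq> T" "l' \<subseteq> T"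
      using vec.span_superset[of "l \<union> l'"] by auto
    obtain \<sigma> where \<sigma>: "\<sigma> \<in> pg_spaces t UNIV" "S \<subseteq> \<sigma>" "T \<subseteq> \<sigma>"
      using join[of S T l] S T l lT by auto
    obtain \<tau> where \<tau>: "\<tau> \<in> pg_spaces t UNIV" "S' \<subseteq> \<tau>" "T \<subseteq> \<tau>"
      using join[of S' T l'] S' T l' lT by auto
    have pt: "p \<in> pg_spaces 0 S" "p \<in> pg_spaces 0 T" "p \<in> pg_spaces 0 S'"
      using p' l l' lT by (auto simp: pg_spaces_def)
    have "W \<pi> p = W \<sigma> p"
      using agree[OF \<pi> \<sigma>(1) S(1,2) S(3) \<sigma>(2) pt(1)] .
    also have "\<dots> = W \<tau> p"
      using agree[OF \<sigma>(1) \<tau>(1) T(1,2) \<sigma>(3) \<tau>(3) pt(2)] .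
    also have "\<dots> = W \<rho> p"
      using agree[OF \<tau>(1) \<rho> S'(1,2) \<tau>(2) S'(3) pt(3)] .
    finally show ?thesis .
  qed
  \<comment> \<open>By \<open>indep\<close> the choice of the t-space through \<open>p\<close> does
    not affect the value.\<close>
  define w where "w p = W (SOME \<pi>. \<pi> \<in> pg_spaces t UNIV \<and> p \<in> pg_spaces 0 \<pi>) p" for p
  have w: "w p = W \<pi> p" if "\<pi> \<in> pg_spaces t UNIV" "p \<in> pg_spaces 0 \<pi>" for \<pi> p
  proof -
    have "\<exists>\<pi>. \<pi> \<in> pg_spaces t UNIV \<and> p \<in> pg_spaces 0 \<pi>"
      using that by blast
    from someI_ex[OF this] show ?thesis
      unfolding w_def using indep that by blast
  qed
  show thesis
  proof (rule that)
    fix K :: "('a ^ 'n) set"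
    assume "K \<in> pg_spaces k UNIV"
    then have K: "vec.subspace K" "vec.dim K = k + 1"
      by (auto simp: pg_spaces_def)
    obtain \<pi> where \<pi>: "vec.subspace \<pi>" "vec.dim \<pi> = t + 1" "K \<subseteq> \<pi>"
      using subspaces_between_nonempty[of K UNIV "t + 1"] K assms(1,2) dimU by auto
    then have "\<pi> \<in> pg_spaces t UNIV" "K \<in> pg_spaces k \<pi>"
      using K by (auto simp: pg_spaces_def)
    then have "indicator L K = (\<Sum>p\<in>pg_spaces 0 K. W \<pi> p)"
      by (rule W)
    also have "\<dots> = (\<Sum>p\<in>pg_spaces 0 K. w p)"
    proof (intro sum.cong refl)
      fix p assume "p \<in> pg_spaces 0 K"
      then have "p \<in> pg_spaces 0 \<pi>"
        using \<pi> by (auto simp: pg_spaces_def)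
      then show "W \<pi> p = w p"
        using w \<open>\<pi> \<in> pg_spaces t UNIV\<close> by simp
    qed
    finally show "indicator L K = (\<Sum>p\<in>pg_spaces 0 K. w p)" .
  qed
qed

section \<open>Counting t-spaces through a k-space, and the equivalence\<close>

theorem theorem5p5:
  fixes L :: "('a::{field,finite} ^ 'n) set set"
    and x :: "('a ^ 'n) set \<Rightarrow> real"
    and n k t q :: nat
    and C :: real
  assumes "q = CARD('a)"
    and "CARD('n) = n + 1"
    and "n \<ge> 2 * k + 2"
    and "2 * k + 1 \<le> t" and "t \<le> n - 1"
    and "L \<subseteq> pg_spaces k UNIV" and "L \<noteq> {}"
    and "\<And>\<pi>. \<pi> \<in> pg_spaces t UNIV \<Longrightarrow>
           cameron_liebler_param k \<pi> {K \<in> L. K \<subseteq> \<pi>} (x \<pi>)"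
  shows "cameron_liebler_param k UNIV L C \<longleftrightarrow>
    (\<forall>K \<in> pg_spaces k UNIV.
       indicator L K
       + ((\<Sum>\<pi> | \<pi> \<in> pg_spaces t UNIV \<and> K \<subseteq> \<pi>. x \<pi>)
          - gauss_binomial q (n - k) (t - k) * indicator L K)
         / gauss_binomial q (n - k - 1) (t - k - 1) = C)"
proof -
  let ?U = "UNIV :: ('a ^ 'n) set"
  have dimU: "vec.dim ?U = n + 1"
    using vec_dim_card assms(2) by metis
  obtain w :: "('a ^ 'n) set \<Rightarrow> real"
    where w: "\<And>K. K \<in> pg_spaces k UNIV \<Longrightarrow> indicator L K = (\<Sum>p\<in>pg_spaces 0 K. w p)"
  proof (rule global_point_weights)
    show "cameron_liebler k \<pi> {K \<in> L. K \<subseteq> \<pi>}" if "\<pi> \<in> pg_spaces t UNIV" for \<pi>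
      using assms(8)[OF that] by (simp add: cameron_liebler_param_def)
  qed (use assms(2-5) in auto)
  define X where "X = (\<Sum>p\<in>pg_spaces 0 ?U. w p)"
  have param: "cameron_liebler_param k UNIV L C \<longleftrightarrow> C = X"
    unfolding X_def using w assms dimU by (intro cameron_liebler_param_iff) auto
  \<comment> \<open>The global weight restricts to a weight on \<pi>, so the given parameter must be
    its total over the points of \<pi>.\<close>
  have x: "x \<pi> = (\<Sum>p\<in>pg_spaces 0 \<pi>. w p)" if \<pi>: "\<pi> \<in> pg_spaces t UNIV" for \<pi>
  proof -
    have "cameron_liebler_param k \<pi> {K \<in> L. K \<subseteq> \<pi>} (x \<pi>) \<longleftrightarrow> x \<pi> = (\<Sum>p\<in>pg_spaces 0 \<pi>. w p)"
    proof (rule cameron_liebler_param_iff)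
      fix K assume K: "K \<in> pg_spaces k \<pi>"
      then have "indicator {K \<in> L. K \<subseteq> \<pi>} K = (indicator L K :: real)"
        by (auto simp: indicator_def pg_spaces_def)
      also have "\<dots> = (\<Sum>p\<in>pg_spaces 0 K. w p)"
        using K by (intro w) (auto simp: pg_spaces_def)
      finally show "indicator {K \<in> L. K \<subseteq> \<pi>} K = (\<Sum>p\<in>pg_spaces 0 K. w p)" .
    qed (use \<pi> assms(4,6) in \<open>auto simp: pg_spaces_def\<close>)
    with assms(8)[OF \<pi>] show ?thesis by simp
  qed
  have "indicator L K + ((\<Sum>\<pi> | \<pi> \<in> pg_spaces t UNIV \<and> K \<subseteq> \<pi>. x \<pi>)
      - gauss_binomial q (n - k) (t - k) * indicator L K)
      / gauss_binomial q (n - k - 1) (t - k - 1) = X" if K: "K \<in> pg_spaces k UNIV" for K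
  proof -
    have K': "vec.subspace K" "vec.dim K = k + 1"
      using K by (auto simp: pg_spaces_def)
    have "{\<pi>. \<pi> \<in> pg_spaces t UNIV \<and> K \<subseteq> \<pi>} = subspaces_between K UNIV (t + 1)"
      by (auto simp: pg_spaces_def subspaces_between_def)
    then have "(\<Sum>\<pi> | \<pi> \<in> pg_spaces t UNIV \<and> K \<subseteq> \<pi>. x \<pi>) =
        (\<Sum>\<pi>\<in>subspaces_between K UNIV (t + 1). \<Sum>p\<in>pg_spaces 0 \<pi>. w p)"
      using x by (intro sum.cong) auto
    \<comment> \<open>The counting lemma with A = K: the dimensions split as n + 1 = (k + 1) + Suc
      (n - k - 1) and t + 1 = (k + 1) + Suc (t - k - 1), with no truncation since t > k. The weight
      over the points of \<open>K\<close> is the indicator.\<close>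
    also have "\<dots> = gauss_binomial q (n - k) (t - k) * indicator L K
        + gauss_binomial q (n - k - 1) (t - k - 1) * (X - indicator L K)"
      using sum_subspaces_between_sum_points[OF K'(1), of UNIV "n - k - 1" "t - k - 1" w]
        K' dimU assms(1,3,4,5) by (simp add: w[OF K] X_def Suc_diff_Suc)
    finally have sum_x: "(\<Sum>\<pi> | \<pi> \<in> pg_spaces t UNIV \<and> K \<subseteq> \<pi>. x \<pi>) = \<dots>" .
    have "gauss_binomial q (n - k - 1) (t - k - 1) > 0"
      using assms two_le_card_field[where 'a='a] by (intro gauss_binomial_pos) auto
    then show ?thesis
      by (simp add: sum_x)
  qed
  \<comment> \<open>Both properties now say C = X. For the second, a member of the non-empty
    \<open>L\<close> supplies a k-space at which to evaluate.\<close>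
  then show ?thesis
    using param assms(6,7) by auto
qed

end
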